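(* Let $q$ be a prime power, let $\kappa\ge 0$ be an integer, and for integers $n,k\ge 0$ let $\tilde v_{n,k}=\mu_\kappa(\{X : \dim_{\mathbb{F}_q}(X\cap V_n)=k\})$. Suppose that $n\geq k\geq 0$ and $\kappa\geq n-k$. Then $\tilde{v}_{n,k}$ is equal to the number of matrices over $\mathbb{F}_q$ of size $\kappa\times n$ which have rank $n-k$, divided by the number of all matrices over $\mathbb{F}_q$ of size $\kappa\times n$. For all other pairs $(n,k)$, $\tilde{v}_{n,k}=0$.
   Context: $\mathbb{F}_q$ is the field with $q$ elements. $\mathrm{Sub}_{\mathbb{F}_q}(\bigoplus_{\mathbb{N}}\mathbb{F}_q)$ is the space of linear subspaces of the countable discrete vector space $\bigoplus_{\mathbb{N}}\mathbb{F}_q$ (topology induced from $\{0,1\}^{\bigoplus_{\mathbb{N}}\mathbb{F}_q}$). For an integer $\kappa\ge 0$, $\mu_\kappa$ is the Borel probability measure on this space that is the law of $\mathrm{Ker}(h)$, where $h$ is a random element of the compact group $\mathrm{Hom}_{\mathbb{F}_q}(\bigoplus_{\mathbb{N}}\mathbb{F}_q,\mathbb{F}_q^\kappa)$ of linear maps (topology of pointwise convergence) distributed according to normalized Haar measure. $V_n=\bigoplus_{1}^n\mathbb{F}_q\subset\bigoplus_{\mathbb{N}}\mathbb{F}_q$ is the span of the first $n$ standard basis vectors. *)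

theory Defs
  imports
    "HOL-Probability.Probability"
    "HOL-Library.Poly_Mapping"
    "Jordan_Normal_Form.DL_Rank"
begin

text \<open>
  The field \<open>\<bbbF>\<^sub>q\<close> is a type \<open>'f :: {field, finite}\<close> (so \<open>q = CARD('f)\<close>), and \<open>\<Oplus>\<^sub>\<nat> \<bbbF>\<^sub>q\<close> is the type
  \<open>nat \<Rightarrow>\<^sub>0 'f\<close> of finitely supported sequences. The target \<open>\<bbbF>\<^sub>q\<^sup>\<kappa>\<close> is \<open>carrier_vec \<kappa>\<close>, which
  allows \<open>\<kappa> = 0\<close>.
\<close>

definition dsum_scale :: "'f::field \<Rightarrow> (nat \<Rightarrow>\<^sub>0 'f) \<Rightarrow> (nat \<Rightarrow>\<^sub>0 'f)" where
  "dsum_scale c x = Poly_Mapping.map (\<lambda>a. c * a) x"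

lemma lookup_dsum_scale: "Poly_Mapping.lookup (dsum_scale c x) i = c * Poly_Mapping.lookup x i"
  by (simp add: dsum_scale_def Poly_Mapping.map.rep_eq when_def)

global_interpretation dsum: vector_space "dsum_scale :: 'f::field \<Rightarrow> _"
  by unfold_locales
    (rule poly_mapping_eqI, simp add: lookup_dsum_scale lookup_add ring_distribs mult.assoc)+

definition V_n :: "nat \<Rightarrow> (nat \<Rightarrow>\<^sub>0 'f::field) set" where
  "V_n n = dsum.span ((\<lambda>i. Poly_Mapping.single i 1) ` {..<n})"

definition Borel_sets_of :: "'a topology \<Rightarrow> 'a measure" where
  "Borel_sets_of T = sigma (topspace T) {U. openin T U}"

definition Sub_topology :: "(nat \<Rightarrow>\<^sub>0 'f::field) set topology" where
  "Sub_topology =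
     pullback_topology {X. dsum.subspace X} (\<lambda>X v. v \<in> X)
       (product_topology (\<lambda>_. discrete_topology (UNIV :: bool set)) UNIV)"

definition Hom_carrier :: "nat \<Rightarrow> ((nat \<Rightarrow>\<^sub>0 'f::field) \<Rightarrow> 'f Matrix.vec) set" where
  "Hom_carrier \<kappa> =
     {h. (\<forall>x. h x \<in> carrier_vec \<kappa>) \<and> (\<forall>x y. h (x + y) = h x + h y) \<and>
         (\<forall>c x. h (dsum_scale c x) = c \<cdot>\<^sub>v h x)}"

definition Hom_topology :: "nat \<Rightarrow> ((nat \<Rightarrow>\<^sub>0 'f::field) \<Rightarrow> 'f Matrix.vec) topology" where
  "Hom_topology \<kappa> =
     subtopology (product_topology (\<lambda>_. discrete_topology (carrier_vec \<kappa>)) UNIV) (Hom_carrier \<kappa>)"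

text \<open>
  Regularity need not be demanded in the following definition when the group is compact and
  metrizable, as \<open>Hom_topology \<kappa>\<close> is: there every finite Borel measure is regular.
\<close>

definition normalized_Haar :: "'a topology \<Rightarrow> ('a \<Rightarrow> 'a \<Rightarrow> 'a) \<Rightarrow> 'a measure \<Rightarrow> bool" where
  "normalized_Haar T gop M \<longleftrightarrow>
     prob_space M \<and> sets M = sets (Borel_sets_of T) \<and>
     (\<forall>g\<in>topspace T. \<forall>A\<in>sets M. emeasure M (gop g ` A) = emeasure M A)"

definition Haar_Hom :: "nat \<Rightarrow> ((nat \<Rightarrow>\<^sub>0 'f::{field, finite}) \<Rightarrow> 'f Matrix.vec) measure" where
  "Haar_Hom \<kappa> = (THE M. normalized_Haar (Hom_topology \<kappa>) (\<lambda>g h x. g x + h x) M)"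

definition Ker :: "nat \<Rightarrow> ((nat \<Rightarrow>\<^sub>0 'f::field) \<Rightarrow> 'f Matrix.vec) \<Rightarrow> (nat \<Rightarrow>\<^sub>0 'f) set" where
  "Ker \<kappa> h = {x. h x = 0\<^sub>v \<kappa>}"

definition mu :: "nat \<Rightarrow> (nat \<Rightarrow>\<^sub>0 'f::{field, finite}) set measure" where
  "mu \<kappa> = distr (Haar_Hom \<kappa>) (Borel_sets_of Sub_topology) (Ker \<kappa>)"

definition v_tilde :: "'f::{field, finite} itself \<Rightarrow> nat \<Rightarrow> nat \<Rightarrow> nat \<Rightarrow> real" where
  "v_tilde _ \<kappa> n k =
     measure (mu \<kappa>) {X :: (nat \<Rightarrow>\<^sub>0 'f) set. dsum.subspace X \<and> dsum.dim (X \<inter> V_n n) = k}"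

end

theory Submission
  imports Defs
begin

text \<open>
  A linear map \<open>h\<close> is determined by the vectors \<open>h e\<^sub>i\<close>, which may be prescribed freely, so \<open>Hom_topology \<kappa>\<close>
  is a countable power of the finite set \<open>carrier_vec \<kappa>\<close>. The sets of maps with prescribed values on
  \<open>e\<^sub>0, \<dots>, e\<^sub>n\<^sub>-\<^sub>1\<close> generate the Borel sets; for fixed \<open>n\<close> they partition the group and
  are translates of each other, so an invariant probability measure gives each of them the same
  mass, which makes it unique. The image of the uniform product measure is such a measure. The values on
  \<open>e\<^sub>0, \<dots>, e\<^sub>n\<^sub>-\<^sub>1\<close> are the columns of a uniformly distributed \<open>\<kappa> \<times> n\<close> matrix, and rank-nullity, proved by counting
  elements over the finite field, turns the dimension of \<open>Ker h \<inter> V_n\<close> into its rank.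
\<close>

unbundle no vec_syntax

section \<open>Vector spaces over finite fields\<close>

text \<open>Coordinates in a finite basis identify \<open>V\<close> with the functions from
  \<open>B\<close> to \<open>K\<close>. This carrier-based version serves the column space of a
  matrix; \<open>card_span_independent\<close> repeats the argument for type-based vector spaces,
  where the kernels live.\<close>

lemma (in vectorspace) card_carrier_eq_power_dim:
  assumes fd: fin_dim and fK: "finite (carrier K)"
  shows "card (carrier V) = card (carrier K) ^ dim"
proof -
  obtain B where B: "finite B" "basis B"
    using finite_basis_exists[OF fd] by blast
  then have li: "lin_indpt B" and gen: "span B = carrier V" and sub: "B \<subseteq> carrier V"
    by (auto simp: basis_def)
  have inj: "inj_on (\<lambda>a. lincomb a B) (B \<rightarrow>\<^sub>E carrier K)"
  proof (rule inj_onI)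
    fix a b assume a: "a \<in> B \<rightarrow>\<^sub>E carrier K" and b: "b \<in> B \<rightarrow>\<^sub>E carrier K"
      and eq: "lincomb a B = lincomb b B"
    have *: "(\<lambda>v. a v \<ominus>\<^bsub>K\<^esub> b v) \<in> B \<rightarrow> carrier K"
      using a b by auto
    have "lincomb (\<lambda>v. a v \<ominus>\<^bsub>K\<^esub> b v) B = \<zero>\<^bsub>V\<^esub>"
      using lincomb_diff[OF B(1) sub, of a b] a b eq sub
      by (auto simp: lincomb_closed PiE_def M.r_neg a_minus_def)
    then have "a v \<ominus>\<^bsub>K\<^esub> b v = \<zero>\<^bsub>K\<^esub>" if "v \<in> B" for v
      using lin_dep_crit[OF B(1) subset_refl * that] li by blast
    moreover have "a v = (a v \<ominus>\<^bsub>K\<^esub> b v) \<oplus>\<^bsub>K\<^esub> b v" "b v \<in> carrier K" if "v \<in> B" for v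
    proof -
      have "a v \<in> carrier K" "b v \<in> carrier K" using that a b by auto
      then show "a v = (a v \<ominus>\<^bsub>K\<^esub> b v) \<oplus>\<^bsub>K\<^esub> b v" "b v \<in> carrier K"
        by (simp_all add: a_minus_def R.a_assoc R.l_neg)
    qed
    ultimately have "a v = b v" if "v \<in> B" for v
      using that by (metis R.l_zero)
    then show "a = b" using a b by (intro PiE_ext)
  qed
  \<comment> \<open>\<open>finite_span\<close> uses all coefficient functions in
    \<open>B \<rightarrow> carrier K\<close>, whereas the counting needs extensional ones;
    restricting the coefficients to \<open>B\<close> leaves the combination unchanged.\<close>
  have img: "(\<lambda>a. lincomb a B) ` (B \<rightarrow>\<^sub>E carrier K) = carrier V"
  proof -
    have *: "lincomb a B = lincomb (restrict a B) B" if "a \<in> B \<rightarrow> carrier K" for a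
      using that sub by (intro lincomb_cong) auto
    have "(\<lambda>a. lincomb a B) ` (B \<rightarrow>\<^sub>E carrier K) = (\<lambda>a. lincomb a B) ` (B \<rightarrow> carrier K)"
    proof (intro equalityI subsetI)
      fix x assume "x \<in> (\<lambda>a. lincomb a B) ` (B \<rightarrow> carrier K)"
      then obtain a where "a \<in> B \<rightarrow> carrier K" "x = lincomb a B" by blast
      then show "x \<in> (\<lambda>a. lincomb a B) ` (B \<rightarrow>\<^sub>E carrier K)"
        using * by (intro image_eqI[of _ _ "restrict a B"]) auto
    qed (auto simp: PiE_def)
    also have "\<dots> = span B" unfolding finite_span[OF B(1) sub] by (rule Setcompr_eq_image[symmetric])
    finally show ?thesis unfolding gen .
  qed
  have "card (carrier V) = card (B \<rightarrow>\<^sub>E carrier K)"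
    using card_image[OF inj] unfolding img .
  also have "\<dots> = card (carrier K) ^ card B"
    using card_PiE[OF B(1), of "\<lambda>_. carrier K"] prod_constant by metis
  also have "\<dots> = card (carrier K) ^ dim"
    by (simp only: dim_basis[OF B])
  finally show ?thesis .
qed

lemma (in vector_space) card_span_independent:
  assumes "finite B" "independent B"
  shows "card (span B) = CARD('a) ^ card B"
proof -
  let ?f = "\<lambda>u. \<Sum>v\<in>B. scale (u v) v"
  have inj: "inj_on ?f (B \<rightarrow>\<^sub>E UNIV)"
  proof (rule inj_onI)
    fix a b assume a: "a \<in> B \<rightarrow>\<^sub>E UNIV" and b: "b \<in> B \<rightarrow>\<^sub>E UNIV" and eq: "?f a = ?f b"
    have "(\<Sum>v\<in>B. scale (a v - b v) v) = 0"
      using eq by (simp add: scale_left_diff_distrib sum_subtractf)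
    then have "a v - b v = 0" if "v \<in> B" for v
      using independentD[OF assms(2,1) subset_refl, of "\<lambda>v. a v - b v"] that by blast
    then show "a = b" using a b by (intro PiE_ext) auto
  qed
  have img: "?f ` (B \<rightarrow>\<^sub>E UNIV) = span B"
  proof -
    have "?f u \<in> ?f ` (B \<rightarrow>\<^sub>E UNIV)" for u
      by (rule image_eqI[of _ _ "restrict u B"]) auto
    then show ?thesis unfolding span_finite[OF assms(1)] by auto
  qed
  have "card (span B) = card (B \<rightarrow>\<^sub>E (UNIV :: 'a set))"
    using card_image[OF inj] unfolding img .
  then show ?thesis using assms by (simp add: card_PiE)
qed

lemma (in vector_space) card_subspace:
  assumes "subspace S" "finite S"
  shows "card S = CARD('a) ^ dim S"
proof -
  obtain B where B: "B \<subseteq> S" "independent B" "S \<subseteq> span B" "card B = dim S"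
    using basis_exists by blast
  have "span B = S" using B assms(1) by (metis span_subspace)
  then show ?thesis using B assms(2) card_span_independent[of B] finite_subset by metis
qed

lemma (in vec_space) span_cols_eq_range:
  assumes "A \<in> carrier_mat n nc"
  shows "span (set (cols A)) = (\<lambda>v. A *\<^sub>v v) ` carrier_vec nc"
  using col_space_eq[OF assms] assms by (auto simp: col_space_def)

text \<open>The range of \<open>A\<close> is its column space, whose dimension is the rank by
  definition, so counting elements of the range recovers the rank.\<close>

lemma card_range_mult_mat_vec:
  fixes A :: "'f::{field, finite} mat"
  assumes A: "A \<in> carrier_mat m nc"
  shows "card ((\<lambda>v. A *\<^sub>v v) ` carrier_vec nc) = CARD('f) ^ vec_space.rank m A"
proof -
  interpret vec_space "TYPE('f)" m .
  have s: "set (cols A) \<subseteq> carrier_vec m" using A cols_dim[of A] by auto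
  interpret W: vectorspace class_ring "span_vs (set (cols A))"
    using span_is_subspace[OF s] subspace_is_vs by simp
  have "card (carrier (span_vs (set (cols A)))) = card (carrier (class_ring :: 'f ring)) ^ W.dim"
    using fin_dim_span_cols[OF A] by (intro W.card_carrier_eq_power_dim) (auto simp: class_ring_simps)
  then show ?thesis
    by (simp add: rank_def span_cols_eq_range[OF A] class_ring_simps)
qed

text \<open>The rank is the size of a maximal independent set of columns, and these lie in a space
  of dimension \<open>m\<close>. The bound yields the vanishing of \<open>v_tilde\<close> when
  \<open>n - k\<close> exceeds \<open>\<kappa>\<close>.\<close>

lemma rank_le_dim_row:
  fixes A :: "'f::field mat"
  assumes A: "A \<in> carrier_mat m nc"
  shows "vec_space.rank m A \<le> m"
proof -
  interpret vec_space "TYPE('f)" m .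
  obtain S where S: "maximal S (\<lambda>T. T \<subseteq> set (cols A) \<and> lin_indpt T)"
    using maximal_exists[of "(\<lambda>T. T \<subseteq> set (cols A) \<and> lin_indpt T)" "card (set (cols A))" "{}"]
    by (meson List.finite_set card_mono empty_iff empty_subsetI finite_lin_indpt2 rev_finite_subset)
  then have "S \<subseteq> carrier V" "lin_indpt S" using A cols_dim[of A] by (auto simp: maximal_def)
  then show ?thesis using rank_card_indpt[OF A S] li_le_dim(2)[OF fin_dim] dim_is_n by simp
qed

section \<open>Linear maps on finitely supported sequences\<close>

abbreviation (input) unit_seq :: "nat \<Rightarrow> nat \<Rightarrow>\<^sub>0 'f::{zero_neq_one}" where
  "unit_seq i \<equiv> Poly_Mapping.single i 1"

lemma lookup_sum_unit_seq:
  fixes c :: "nat \<Rightarrow> 'f::field"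
  assumes "finite F"
  shows "Poly_Mapping.lookup (\<Sum>i\<in>F. dsum_scale (c i) (unit_seq i)) k = (if k \<in> F then c k else 0)"
proof -
  have "Poly_Mapping.lookup (\<Sum>i\<in>F. dsum_scale (c i) (unit_seq i)) k = (\<Sum>i\<in>F. if i = k then c i else 0)"
    unfolding lookup_sum by (intro sum.cong) (auto simp: lookup_dsum_scale lookup_single when_def)
  then show ?thesis using assms by simp
qed

lemma dsum_expansion:
  "(\<Sum>i\<in>Poly_Mapping.keys x. dsum_scale (Poly_Mapping.lookup x i) (unit_seq i)) = x"
  by (rule poly_mapping_eqI) (simp add: lookup_sum_unit_seq in_keys_iff)

text \<open>The vectors whose coordinates vanish from \<open>n\<close> on form a subspace containing
  the generators, which gives one inclusion; expansion in unit sequences gives the other.\<close>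

lemma V_n_eq_keys: "(V_n n :: (nat \<Rightarrow>\<^sub>0 'f::field) set) = {x. Poly_Mapping.keys x \<subseteq> {..<n}}"
proof (intro equalityI subsetI)
  fix x :: "nat \<Rightarrow>\<^sub>0 'f" assume "x \<in> V_n n"
  moreover have "dsum.subspace {x :: nat \<Rightarrow>\<^sub>0 'f. \<forall>k\<ge>n. Poly_Mapping.lookup x k = 0}"
    by (rule dsum.subspaceI) (auto simp: lookup_add lookup_dsum_scale)
  then have "V_n n \<subseteq> {x :: nat \<Rightarrow>\<^sub>0 'f. \<forall>k\<ge>n. Poly_Mapping.lookup x k = 0}"
    unfolding V_n_def by (intro dsum.span_minimal) (auto simp: lookup_single)
  ultimately show "x \<in> {x. Poly_Mapping.keys x \<subseteq> {..<n}}"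
    by (fastforce simp: in_keys_iff not_less[symmetric])
next
  fix x :: "nat \<Rightarrow>\<^sub>0 'f" assume "x \<in> {x. Poly_Mapping.keys x \<subseteq> {..<n}}"
  then have "(\<Sum>i\<in>Poly_Mapping.keys x. dsum_scale (Poly_Mapping.lookup x i) (unit_seq i)) \<in> V_n n"
    unfolding V_n_def by (intro dsum.span_sum dsum.span_scale dsum.span_base) auto
  then show "x \<in> V_n n" by (simp only: dsum_expansion)
qed

lemma subspace_V_n: "dsum.subspace (V_n n)"
  unfolding V_n_def by (rule dsum.subspace_span)

lemma dsum_in_V_n: "\<exists>n. x \<in> V_n n"
  unfolding V_n_eq_keys using finite_nat_set_iff_bounded[of "Poly_Mapping.keys x"] by auto

lemma V_n_mono: "m \<le> n \<Longrightarrow> V_n m \<subseteq> V_n n"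
  unfolding V_n_eq_keys by auto

lemma card_V_n: "card (V_n n :: (nat \<Rightarrow>\<^sub>0 'f::{field, finite}) set) = CARD('f) ^ n"
proof -
  \<comment> \<open>The basis is an image set, so it has \<open>n\<close> elements only because the
    unit sequences are distinct.\<close>
  have inj: "inj_on (\<lambda>i. unit_seq i :: nat \<Rightarrow>\<^sub>0 'f) {..<n}"
    by (rule inj_onI) (metis lookup_single_eq lookup_single_not_eq zero_neq_one)
  let ?B = "(\<lambda>i. unit_seq i :: nat \<Rightarrow>\<^sub>0 'f) ` {..<n}"
  have "dsum.independent ?B"
  proof (rule dsum.independent_if_scalars_zero)
    fix f :: "(nat \<Rightarrow>\<^sub>0 'f) \<Rightarrow> 'f" and x
    assume 0: "(\<Sum>x\<in>?B. dsum_scale (f x) x) = 0" and x: "x \<in> ?B"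
    obtain k where k: "k < n" "x = unit_seq k" using x by auto
    have "(\<Sum>i<n. dsum_scale (f (unit_seq i)) (unit_seq i)) = 0"
      using 0 by (simp add: sum.reindex[OF inj])
    then have "Poly_Mapping.lookup (\<Sum>i<n. dsum_scale (f (unit_seq i)) (unit_seq i)) k = 0" by simp
    then show "f x = 0" using k by (simp add: lookup_sum_unit_seq)
  qed simp
  then show ?thesis
    using dsum.card_span_independent[of ?B] by (simp add: V_n_def card_image[OF inj])
qed

lemma finite_V_n: "finite (V_n n :: (nat \<Rightarrow>\<^sub>0 'f::{field, finite}) set)"
  by (rule card_ge_0_finite) (simp add: card_V_n)

section \<open>Linear extension of prescribed values\<close>

definition lin_ext :: "nat \<Rightarrow> (nat \<Rightarrow> 'f::field vec) \<Rightarrow> (nat \<Rightarrow>\<^sub>0 'f) \<Rightarrow> 'f vec" where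
  "lin_ext \<kappa> a x = vec \<kappa> (\<lambda>j. \<Sum>i\<in>Poly_Mapping.keys x. Poly_Mapping.lookup x i * a i $ j)"

text \<open>Indices outside the support contribute zero coefficients. Several vectors can thus be
  summed over one common index set, as the proof of additivity requires.\<close>

lemma lin_ext_superset:
  assumes "finite F" "Poly_Mapping.keys x \<subseteq> F"
  shows "lin_ext \<kappa> a x = vec \<kappa> (\<lambda>j. \<Sum>i\<in>F. Poly_Mapping.lookup x i * a i $ j)"
  unfolding lin_ext_def using assms
  by (intro eq_vecI) (auto intro!: sum.mono_neutral_left simp: in_keys_iff)

lemma lin_ext_unit_seq:
  fixes a :: "nat \<Rightarrow> 'f::field vec"
  assumes "a i \<in> carrier_vec \<kappa>"
  shows "lin_ext \<kappa> a (unit_seq i) = a i"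
  using assms by (intro eq_vecI) (auto simp: lin_ext_superset[of "{i}"])

text \<open>The coordinatewise sums always form a vector of dimension \<open>\<kappa>\<close> and
  are linear in the coefficients of \<open>x\<close>, whatever the family \<open>a\<close> is; the
  value at the \<open>i\<close>-th unit sequence is \<open>a i\<close> once \<open>a i\<close> lies
  in \<open>carrier_vec \<kappa>\<close>.\<close>

lemma lin_ext_in_Hom: "lin_ext \<kappa> a \<in> Hom_carrier \<kappa>"
proof -
  have "lin_ext \<kappa> a (x + y) = lin_ext \<kappa> a x + lin_ext \<kappa> a y" for x y
  proof -
    let ?F = "Poly_Mapping.keys x \<union> Poly_Mapping.keys y"
    have "Poly_Mapping.keys (x + y) \<subseteq> ?F" by (rule keys_add)
    then show ?thesis
      by (intro eq_vecI)
         (auto simp: lin_ext_superset[of ?F] lookup_add ring_distribs sum.distrib)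
  qed
  moreover have "lin_ext \<kappa> a (dsum_scale c x) = c \<cdot>\<^sub>v lin_ext \<kappa> a x" for c x
  proof -
    have "Poly_Mapping.keys (dsum_scale c x) \<subseteq> Poly_Mapping.keys x"
      by (auto simp: in_keys_iff lookup_dsum_scale)
    then show ?thesis
      by (intro eq_vecI)
         (auto simp: lin_ext_superset[of "Poly_Mapping.keys x"] lookup_dsum_scale sum_distrib_left mult.assoc)
  qed
  ultimately show ?thesis by (auto simp: Hom_carrier_def lin_ext_def)
qed

lemma HomD:
  assumes "h \<in> Hom_carrier \<kappa>"
  shows "h x \<in> carrier_vec \<kappa>" "h (x + y) = h x + h y" "h (dsum_scale c x) = c \<cdot>\<^sub>v h x"
  using assms by (auto simp: Hom_carrier_def)

lemma Hom_zero:
  assumes h: "h \<in> Hom_carrier \<kappa>"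
  shows "h 0 = 0\<^sub>v \<kappa>"
proof (rule eq_vecI)
  have d: "dim_vec (h 0) = \<kappa>" using HomD(1)[OF h, of 0] by simp
  then show "dim_vec (h 0) = dim_vec (0\<^sub>v \<kappa>)" by simp
  show "h 0 $ i = 0\<^sub>v \<kappa> $ i" if "i < dim_vec (0\<^sub>v \<kappa>)" for i
    \<comment> \<open>Homogeneity for the scalar \<open>0\<close> and the vector \<open>0\<close>:
      each coordinate of \<open>h 0\<close> equals \<open>0\<close> times itself.\<close>
    using that d arg_cong[OF HomD(3)[OF h, of 0 0], of "\<lambda>v. v $ i"] by simp
qed

lemma Hom_minus:
  assumes h: "h \<in> Hom_carrier \<kappa>"
  shows "h (x - y) = h x - h y"
proof -
  have "h x = h (x - y) + h y" using HomD(2)[OF h, of "x - y" y] by simp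
  then show ?thesis using HomD(1)[OF h, of x] HomD(1)[OF h, of y] HomD(1)[OF h, of "x - y"]
    by (intro eq_vecI) auto
qed

text \<open>Induction over a finite index set extends additivity and homogeneity to linear
  combinations of unit sequences; the expansion of \<open>x\<close> is one of these.\<close>

lemma Hom_eq_lin_ext:
  assumes h: "h \<in> Hom_carrier \<kappa>"
  shows "h x = lin_ext \<kappa> (\<lambda>i. h (unit_seq i)) x"
proof -
  have "h (\<Sum>i\<in>F. dsum_scale (c i) (unit_seq i)) $ j = (\<Sum>i\<in>F. c i * h (unit_seq i) $ j)"
    if "finite F" "j < \<kappa>" for F c j
    using that(1)
  proof (induction F rule: finite_induct)
    case empty
    then show ?case using that(2) by (simp add: Hom_zero[OF h])
  next
    case (insert i F)
    have "dim_vec (h z) = \<kappa>" for z using HomD(1)[OF h, of z] by simp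
    with insert show ?case using that(2) by (simp add: HomD(2,3)[OF h])
  qed
  from this[of "Poly_Mapping.keys x" _ "Poly_Mapping.lookup x"]
  show ?thesis
    using HomD(1)[OF h, of x] by (intro eq_vecI) (auto simp: lin_ext_def dsum_expansion)
qed

lemma Hom_eq_on_V_n:
  assumes "h \<in> Hom_carrier \<kappa>" "h' \<in> Hom_carrier \<kappa>"
    and "\<And>i. i < n \<Longrightarrow> h (unit_seq i) = h' (unit_seq i)" and "x \<in> V_n n"
  shows "h x = h' x"
proof -
  have "lin_ext \<kappa> (\<lambda>i. h (unit_seq i)) x = lin_ext \<kappa> (\<lambda>i. h' (unit_seq i)) x"
  proof -
    have "h (unit_seq i) = h' (unit_seq i)" if "i \<in> Poly_Mapping.keys x" for i
      using assms(3,4) that by (auto simp: V_n_eq_keys)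
    then show ?thesis by (simp add: lin_ext_def)
  qed
  then show ?thesis using Hom_eq_lin_ext assms(1,2) by metis
qed

section \<open>Matrices of restrictions to \<open>V_n\<close>, and rank-nullity\<close>

lemma Hom_eq_mult_mat_vec:
  assumes h: "h \<in> Hom_carrier \<kappa>" and x: "x \<in> V_n n"
    and A: "A \<in> carrier_mat \<kappa> n" and c: "\<And>i. i < n \<Longrightarrow> h (unit_seq i) = col A i"
  shows "h x = A *\<^sub>v vec n (Poly_Mapping.lookup x)"
proof -
  have "h x = vec \<kappa> (\<lambda>j. \<Sum>i<n. Poly_Mapping.lookup x i * h (unit_seq i) $ j)"
    using lin_ext_superset[of "{..<n}" x] x by (subst Hom_eq_lin_ext[OF h]) (simp add: V_n_eq_keys)
  also have "\<dots> = A *\<^sub>v vec n (Poly_Mapping.lookup x)"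
    using A by (intro eq_vecI) (auto simp: scalar_prod_def c mult.commute lessThan_atLeast0 intro!: sum.cong)
  finally show ?thesis .
qed

lemma Hom_image_V_n:
  assumes h: "h \<in> Hom_carrier \<kappa>"
    and A: "A \<in> carrier_mat \<kappa> n" and c: "\<And>i. i < n \<Longrightarrow> h (unit_seq i) = col A i"
  shows "h ` V_n n = (\<lambda>v. A *\<^sub>v v) ` carrier_vec n"
proof (intro equalityI subsetI)
  fix y assume "y \<in> h ` V_n n"
  then obtain x where "x \<in> V_n n" "y = h x" by blast
  then show "y \<in> (\<lambda>v. A *\<^sub>v v) ` carrier_vec n"
    using Hom_eq_mult_mat_vec[OF h _ A c, of x] by auto
next
  fix y assume "y \<in> (\<lambda>v. A *\<^sub>v v) ` carrier_vec n"
  then obtain v where v: "v \<in> carrier_vec n" "y = A *\<^sub>v v" by blast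
  let ?x = "\<Sum>i<n. dsum_scale (v $ i) (unit_seq i)"
  have "?x \<in> V_n n"
    unfolding V_n_def by (intro dsum.span_sum dsum.span_scale dsum.span_base) auto
  moreover have "vec n (Poly_Mapping.lookup ?x) = v"
    using v by (intro eq_vecI) (auto simp: lookup_sum_unit_seq)
  ultimately show "y \<in> h ` V_n n"
    using Hom_eq_mult_mat_vec[OF h _ A c, of ?x] v(2) by (intro image_eqI[of _ _ ?x]) simp_all
qed

lemma subspace_Ker: "h \<in> Hom_carrier \<kappa> \<Longrightarrow> dsum.subspace (Ker \<kappa> h)"
  by (rule dsum.subspaceI) (auto simp: Ker_def Hom_zero HomD)

text \<open>Every nonempty fibre of \<open>h\<close> on \<open>V_n n\<close> is a translate of the
  kernel, so all of them have the same size.\<close>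

lemma card_V_n_eq_image_Ker:
  fixes h :: "(nat \<Rightarrow>\<^sub>0 'f::{field, finite}) \<Rightarrow> 'f vec"
  assumes h: "h \<in> Hom_carrier \<kappa>"
  shows "card (V_n n :: (nat \<Rightarrow>\<^sub>0 'f) set) = card (h ` V_n n) * card (Ker \<kappa> h \<inter> V_n n)"
proof -
  have fib: "card {x \<in> V_n n. h x = y} = card (Ker \<kappa> h \<inter> V_n n)" if "y \<in> h ` V_n n" for y
  proof -
    obtain x0 where x0: "x0 \<in> V_n n" "y = h x0" using \<open>y \<in> h ` V_n n\<close> by blast
    have c: "h z \<in> carrier_vec \<kappa>" for z using HomD(1)[OF h] .
    have "bij_betw (\<lambda>z. x0 + z) (Ker \<kappa> h \<inter> V_n n) {x \<in> V_n n. h x = y}"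
    proof (rule bij_betw_byWitness[where f' = "\<lambda>x. x - x0"])
      show "(\<lambda>z. x0 + z) ` (Ker \<kappa> h \<inter> V_n n) \<subseteq> {x \<in> V_n n. h x = y}"
        using x0 c by (auto simp: Ker_def HomD(2)[OF h] dsum.subspace_add[OF subspace_V_n])
      show "(\<lambda>x. x - x0) ` {x \<in> V_n n. h x = y} \<subseteq> Ker \<kappa> h \<inter> V_n n"
        using x0 c by (auto simp: Ker_def Hom_minus[OF h] dsum.subspace_diff[OF subspace_V_n])
    qed auto
    then show ?thesis by (rule bij_betw_same_card[symmetric])
  qed
  have "card (V_n n :: (nat \<Rightarrow>\<^sub>0 'f) set) = (\<Sum>y\<in>h ` V_n n. card {x \<in> V_n n. h x = y})"
    using sum.image_gen[OF finite_V_n, of "\<lambda>_. 1::nat" n h] by simp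
  then show ?thesis using fib by simp
qed

text \<open>Rank-nullity: domain, image and kernel have cardinalities that are powers of the field
  size, and since this exceeds 1 the exponents can be compared.\<close>

lemma dim_Ker_V_n:
  fixes h :: "(nat \<Rightarrow>\<^sub>0 'f::{field, finite}) \<Rightarrow> 'f vec"
  assumes h: "h \<in> Hom_carrier \<kappa>"
    and A: "A \<in> carrier_mat \<kappa> n" and c: "\<And>i. i < n \<Longrightarrow> h (unit_seq i) = col A i"
  shows "dsum.dim (Ker \<kappa> h \<inter> V_n n) + vec_space.rank \<kappa> A = n"
proof -
  have "CARD('f) ^ n = CARD('f) ^ vec_space.rank \<kappa> A * CARD('f) ^ dsum.dim (Ker \<kappa> h \<inter> V_n n)"
    using card_V_n_eq_image_Ker[OF h, of n] Hom_image_V_n[OF h A c] card_range_mult_mat_vec[OF A]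
      dsum.card_subspace[OF dsum.subspace_inter[OF subspace_Ker[OF h] subspace_V_n[of n]]]
    by (simp add: card_V_n finite_V_n)
  then have "CARD('f) ^ n = CARD('f) ^ (dsum.dim (Ker \<kappa> h \<inter> V_n n) + vec_space.rank \<kappa> A)"
    by (simp add: power_add mult.commute)
  moreover have "CARD('f) > 1"
    using card_mono[of UNIV "{0, 1 :: 'f}"] by simp
  ultimately show ?thesis using power_inject_exp by metis
qed

section \<open>Borel sets of the group of homomorphisms\<close>

lemma space_Borel_sets_of: "space (Borel_sets_of T) = topspace T"
  unfolding Borel_sets_of_def by (intro space_measure_of) (auto dest: openin_subset)

lemma sets_Borel_sets_of: "sets (Borel_sets_of T) = sigma_sets (topspace T) {U. openin T U}"
  unfolding Borel_sets_of_def by (intro sets_measure_of) (auto dest: openin_subset)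

lemma openin_imp_Borel: "openin T U \<Longrightarrow> U \<in> sets (Borel_sets_of T)"
  unfolding sets_Borel_sets_of by (intro sigma_sets.Basic) simp

lemma continuous_map_imp_Borel_measurable:
  assumes f: "continuous_map S T f"
  shows "f \<in> measurable (Borel_sets_of S) (Borel_sets_of T)"
proof (rule measurable_sigma_sets[OF sets_Borel_sets_of])
  show "f \<in> space (Borel_sets_of S) \<rightarrow> topspace T"
    using continuous_map_image_subset_topspace[OF f] by (auto simp: space_Borel_sets_of)
  fix U assume "U \<in> {U. openin T U}"
  then have "openin S {x \<in> topspace S. f x \<in> U}"
    using openin_continuous_map_preimage[OF f] by simp
  moreover have "f -` U \<inter> space (Borel_sets_of S) = {x \<in> topspace S. f x \<in> U}"
    by (auto simp: space_Borel_sets_of)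
  ultimately show "f -` U \<inter> space (Borel_sets_of S) \<in> sets (Borel_sets_of S)"
    by (simp add: openin_imp_Borel)
qed (auto dest: openin_subset)

section \<open>Matrices as families of columns\<close>

lemma finite_carrier_vec: "finite (carrier_vec n :: 'a::finite vec set)"
proof -
  have "carrier_vec n \<subseteq> vec n ` ({..<n} \<rightarrow>\<^sub>E (UNIV :: 'a set))"
  proof
    fix v :: "'a vec" assume "v \<in> carrier_vec n"
    then show "v \<in> vec n ` ({..<n} \<rightarrow>\<^sub>E UNIV)"
      by (intro image_eqI[of _ _ "restrict (\<lambda>i. v $ i) {..<n}"]) auto
  qed
  then show ?thesis by (rule finite_subset) (auto intro!: finite_PiE)
qed

text \<open>Columns of index at least \<open>n\<close> have unspecified entries, so the family is
  cut off at \<open>n\<close>; the inverse assembles a matrix from its columns. The bijection counts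
  matrices and later separates the cylinders of distinct matrices.\<close>

lemma bij_betw_cols:
  "bij_betw (\<lambda>A. restrict (col A) {..<n}) (carrier_mat m n :: 'a mat set) ({..<n} \<rightarrow>\<^sub>E carrier_vec m)"
proof (rule bij_betw_byWitness[where f' = "\<lambda>c. mat m n (\<lambda>(j, i). c i $ j)"])
  show "\<forall>A\<in>carrier_mat m n :: 'a mat set. mat m n (\<lambda>(j, i). restrict (col A) {..<n} i $ j) = A"
    by (auto intro!: eq_matI)
  show "\<forall>c\<in>{..<n} \<rightarrow>\<^sub>E (carrier_vec m :: 'a vec set). restrict (col (mat m n (\<lambda>(j, i). c i $ j))) {..<n} = c"
  proof
    fix c :: "nat \<Rightarrow> 'a vec" assume c: "c \<in> {..<n} \<rightarrow>\<^sub>E carrier_vec m"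
    then have "col (mat m n (\<lambda>(j, i). c i $ j)) i = c i" if "i < n" for i
      using that PiE_mem[OF c, of i] by (intro eq_vecI) auto
    then show "restrict (col (mat m n (\<lambda>(j, i). c i $ j))) {..<n} = c"
      using c by (intro PiE_ext[of _ "{..<n}" "\<lambda>_. UNIV"]) auto
  qed
  show "(\<lambda>A. restrict (col A) {..<n}) ` carrier_mat m n \<subseteq> {..<n} \<rightarrow>\<^sub>E (carrier_vec m :: 'a vec set)"
    by (intro image_subsetI restrict_PiE_iff[THEN iffD2]) auto
  show "(\<lambda>c. mat m n (\<lambda>(j, i). c i $ j)) ` ({..<n} \<rightarrow>\<^sub>E (carrier_vec m :: 'a vec set)) \<subseteq> carrier_mat m n"
    by (intro image_subsetI mat_carrier)
qed

lemma card_carrier_mat: "card (carrier_mat m n :: 'a mat set) = card (carrier_vec m :: 'a vec set) ^ n"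
  using bij_betw_same_card[OF bij_betw_cols[of n m]] by (simp add: card_PiE)

section \<open>Cylinders and the topology of the group\<close>

lemma topspace_Hom_topology: "topspace (Hom_topology \<kappa>) = Hom_carrier \<kappa>"
  by (auto simp: Hom_topology_def HomD)

lemma continuous_map_Hom_eval:
  "continuous_map (Hom_topology \<kappa>) (discrete_topology (carrier_vec \<kappa>)) (\<lambda>h. h x)"
  unfolding Hom_topology_def
  by (intro continuous_map_from_subtopology continuous_map_product_projection UNIV_I)

text \<open>When the first \<open>n\<close> values of \<open>c\<close> lie in
  \<open>carrier_vec \<kappa>\<close>, this is a coset of the subgroup of homomorphisms that vanish
  on \<open>V_n n\<close>.\<close>

definition cylinder :: "nat \<Rightarrow> nat \<Rightarrow> (nat \<Rightarrow> 'f::field vec) \<Rightarrow> ((nat \<Rightarrow>\<^sub>0 'f) \<Rightarrow> 'f vec) set" where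
  "cylinder \<kappa> n c = {h \<in> Hom_carrier \<kappa>. \<forall>i<n. h (unit_seq i) = c i}"

lemma cylinder_subset_Hom: "cylinder \<kappa> n c \<subseteq> Hom_carrier \<kappa>"
  by (auto simp: cylinder_def)

lemma cylinder_0: "cylinder \<kappa> 0 c = Hom_carrier \<kappa>"
  by (simp add: cylinder_def)

lemma cylinder_cong: "(\<And>i. i < n \<Longrightarrow> c i = d i) \<Longrightarrow> cylinder \<kappa> n c = cylinder \<kappa> n d"
  by (auto simp: cylinder_def)

lemma cylinder_empty: "i < n \<Longrightarrow> c i \<notin> carrier_vec \<kappa> \<Longrightarrow> cylinder \<kappa> n c = {}"
  by (auto simp: cylinder_def) (metis HomD(1))

lemma openin_cylinder: "openin (Hom_topology \<kappa>) (cylinder \<kappa> n c)"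
proof (induction n)
  case 0
  then show ?case by (metis cylinder_0 openin_topspace topspace_Hom_topology)
next
  case (Suc n)
  \<comment> \<open>Intersecting with \<open>carrier_vec \<kappa>\<close> gives an open set of the
    discrete target even if \<open>c n\<close> lies outside it, in which case both sides are
    empty.\<close>
  have "cylinder \<kappa> (Suc n) c = cylinder \<kappa> n c \<inter>
      {h \<in> topspace (Hom_topology \<kappa>). h (unit_seq n) \<in> {c n} \<inter> carrier_vec \<kappa>}"
    using HomD(1) by (fastforce simp: cylinder_def topspace_Hom_topology less_Suc_eq)
  moreover have "openin (Hom_topology \<kappa>) {h \<in> topspace (Hom_topology \<kappa>). h (unit_seq n) \<in> {c n} \<inter> carrier_vec \<kappa>}"
    by (rule openin_continuous_map_preimage[OF continuous_map_Hom_eval]) simp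
  ultimately show ?case using Suc by (simp add: openin_Int)
qed

text \<open>A basic neighbourhood of \<open>h\<close> constrains the values at finitely many
  vectors. All of these lie in a single \<open>V_n n\<close>, where a homomorphism is determined by
  its values on the first \<open>n\<close> unit sequences.\<close>

lemma openin_Hom_contains_cylinder:
  fixes U :: "((nat \<Rightarrow>\<^sub>0 'f::field) \<Rightarrow> 'f vec) set"
  assumes U: "openin (Hom_topology \<kappa>) U" and h: "h \<in> U"
  obtains n where "cylinder \<kappa> n (\<lambda>i. h (unit_seq i)) \<subseteq> U"
proof -
  have hH: "h \<in> Hom_carrier \<kappa>"
    using openin_subset[OF U] h by (auto simp: topspace_Hom_topology)
  obtain T where T: "openin (product_topology (\<lambda>_. discrete_topology (carrier_vec \<kappa>)) UNIV) T"
    and UT: "U = T \<inter> Hom_carrier \<kappa>"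
    using U unfolding Hom_topology_def openin_subtopology by blast
  obtain X where X: "finite {x. X x \<noteq> carrier_vec \<kappa>}" "h \<in> Pi\<^sub>E UNIV X" "Pi\<^sub>E UNIV X \<subseteq> T"
    using T h UT unfolding openin_product_topology_alt by auto
  obtain N where N: "\<And>x :: nat \<Rightarrow>\<^sub>0 'f. x \<in> V_n (N x)" using dsum_in_V_n by metis
  obtain n where n: "\<And>x. X x \<noteq> carrier_vec \<kappa> \<Longrightarrow> N x \<le> n"
    using finite_nat_set_iff_bounded_le[of "N ` {x. X x \<noteq> carrier_vec \<kappa>}"] X(1) by auto
  have "h' \<in> U" if h': "h' \<in> cylinder \<kappa> n (\<lambda>i. h (unit_seq i))" for h'
  proof -
    have H': "h' \<in> Hom_carrier \<kappa>" using h' by (simp add: cylinder_def)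
    have "h' x \<in> X x" for x
    proof (cases "X x = carrier_vec \<kappa>")
      case True
      then show ?thesis using HomD(1)[OF H'] by simp
    next
      case False
      then have "x \<in> V_n n" using N[of x] V_n_mono[OF n] by auto
      then have "h' x = h x"
        using Hom_eq_on_V_n[OF H' hH, of n x] h' unfolding cylinder_def by blast
      then show ?thesis using X(2) by auto
    qed
    then have "h' \<in> T" using X(3) by auto
    then show ?thesis using H' UT by simp
  qed
  then show ?thesis using that by blast
qed

definition cylinders :: "nat \<Rightarrow> ((nat \<Rightarrow>\<^sub>0 'f::field) \<Rightarrow> 'f vec) set set" where
  "cylinders \<kappa> = insert {} (range (\<lambda>(n, c). cylinder \<kappa> n c))"

lemma cylinders_subset_Pow: "cylinders \<kappa> \<subseteq> Pow (Hom_carrier \<kappa>)"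
  using cylinder_subset_Hom by (auto simp: cylinders_def)

lemma cylinder_in_cylinders: "cylinder \<kappa> n c \<in> cylinders \<kappa>"
  unfolding cylinders_def by (auto intro!: image_eqI[of _ _ "(n, c)"])

text \<open>Two cylinders are nested if their data agree on the common range of indices, and
  disjoint otherwise.\<close>

lemma Int_stable_cylinders: "Int_stable (cylinders \<kappa> :: ((nat \<Rightarrow>\<^sub>0 'f::field) \<Rightarrow> 'f vec) set set)"
proof -
  have le: "cylinder \<kappa> n c \<inter> cylinder \<kappa> m d \<in> cylinders \<kappa>" if "n \<le> m" for n m and c d :: "nat \<Rightarrow> 'f vec"
  proof (cases "\<forall>i<n. c i = d i")
    case True
    then have "cylinder \<kappa> n c \<inter> cylinder \<kappa> m d = cylinder \<kappa> m d"
      using that by (auto simp: cylinder_def)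
    then show ?thesis by (simp add: cylinder_in_cylinders)
  next
    case False
    then have "cylinder \<kappa> n c \<inter> cylinder \<kappa> m d = {}"
      using that by (fastforce simp: cylinder_def)
    then show ?thesis by (simp add: cylinders_def)
  qed
  have "cylinder \<kappa> n c \<inter> cylinder \<kappa> m d \<in> cylinders \<kappa>" for n m and c d :: "nat \<Rightarrow> 'f vec"
    using le[of n m c d] le[of m n d c] by (metis Int_commute nat_le_linear)
  moreover have "{} \<in> (cylinders \<kappa> :: ((nat \<Rightarrow>\<^sub>0 'f) \<Rightarrow> 'f vec) set set)" by (simp add: cylinders_def)
  ultimately have "C \<inter> D \<in> cylinders \<kappa>" if "C \<in> cylinders \<kappa>" "D \<in> cylinders \<kappa>"
    for C D :: "((nat \<Rightarrow>\<^sub>0 'f) \<Rightarrow> 'f vec) set"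
    using that(1,2)[unfolded cylinders_def] by auto
  then show ?thesis by (rule Int_stableI)
qed

text \<open>Every open set is the union of the cylinders it contains, and a countable family of
  cylinders suffices because the field is finite. Conversely, cylinders are open.\<close>

lemma sets_Borel_Hom:
  "sets (Borel_sets_of (Hom_topology \<kappa> :: ((nat \<Rightarrow>\<^sub>0 'f::{field, finite}) \<Rightarrow> 'f vec) topology)) =
     sigma_sets (Hom_carrier \<kappa>) (cylinders \<kappa>)"
proof -
  have "U \<in> sigma_sets (Hom_carrier \<kappa>) (cylinders \<kappa>)" if U: "openin (Hom_topology \<kappa>) U"
    for U :: "((nat \<Rightarrow>\<^sub>0 'f) \<Rightarrow> 'f vec) set"
  proof -
    \<comment> \<open>Extensional data with values in \<open>carrier_vec \<kappa>\<close> leave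
      finitely many choices for each \<open>n\<close>, hence countably many cylinders in
      all.\<close>
    let ?C = "(\<lambda>(n, c). cylinder \<kappa> n c) ` (SIGMA n:UNIV. {..<n} \<rightarrow>\<^sub>E (carrier_vec \<kappa> :: 'f vec set))"
    let ?D = "{C \<in> ?C. C \<subseteq> U} :: ((nat \<Rightarrow>\<^sub>0 'f) \<Rightarrow> 'f vec) set set"
    have "finite ({..<n} \<rightarrow>\<^sub>E (carrier_vec \<kappa> :: 'f vec set))" for n :: nat
      by (intro finite_PiE finite_carrier_vec) simp
    then have "countable ?C"
      by (intro countable_image countable_SIGMA countableI_type countable_finite)
    then have D: "countable ?D" by (rule countable_subset[rotated]) auto
    have "\<Union>?D = U"
    proof (intro equalityI subsetI)
      fix h assume h: "h \<in> U"
      then have hH: "h \<in> Hom_carrier \<kappa>"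
        using openin_subset[OF U] by (auto simp: topspace_Hom_topology)
      obtain n where n: "cylinder \<kappa> n (\<lambda>i. h (unit_seq i)) \<subseteq> U"
        using openin_Hom_contains_cylinder[OF U h] .
      let ?c = "restrict (\<lambda>i. h (unit_seq i)) {..<n}"
      have eq: "cylinder \<kappa> n ?c = cylinder \<kappa> n (\<lambda>i. h (unit_seq i))"
        by (rule cylinder_cong) simp
      have "cylinder \<kappa> n ?c \<in> ?C"
        using HomD(1)[OF hH] by (intro image_eqI[of _ _ "(n, ?c)"]) auto
      then have "cylinder \<kappa> n ?c \<in> ?D" using n eq by simp
      moreover have "h \<in> cylinder \<kappa> n ?c" using hH by (simp add: cylinder_def)
      ultimately show "h \<in> \<Union>?D" by (rule UnionI)
    qed auto
    moreover have "\<Union>?D \<in> sigma_sets (Hom_carrier \<kappa>) (cylinders \<kappa>)"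
      by (rule sigma_sets_UNION[OF D]) (auto intro!: sigma_sets.Basic cylinder_in_cylinders)
    ultimately show ?thesis by simp
  qed
  moreover have "openin (Hom_topology \<kappa>) C" if "C \<in> cylinders \<kappa>" for C :: "((nat \<Rightarrow>\<^sub>0 'f) \<Rightarrow> 'f vec) set"
    using that openin_cylinder by (auto simp: cylinders_def)
  ultimately show ?thesis
    unfolding sets_Borel_sets_of topspace_Hom_topology
    by (intro equalityI sigma_sets_mono) auto
qed

section \<open>Haar measure\<close>

text \<open>A cylinder with a prescribed value outside \<open>carrier_vec \<kappa>\<close> is empty,
  so only admissible data need be considered.\<close>

lemma cylinders_cases:
  assumes "C \<in> cylinders \<kappa>"
  obtains "C = {}" | n c where "C = cylinder \<kappa> n c" "\<And>i. i < n \<Longrightarrow> c i \<in> carrier_vec \<kappa>"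
proof (cases "C = {}")
  case False
  then obtain n c where C: "C = cylinder \<kappa> n c" using assms by (auto simp: cylinders_def)
  moreover have "c i \<in> carrier_vec \<kappa>" if "i < n" for i
    using that False C cylinder_empty by blast
  ultimately show ?thesis using that(2) by blast
qed (rule that(1))

lemma card_carrier_vec_pos: "0 < card (carrier_vec n :: 'a::{zero, finite} vec set)"
  using zero_carrier_vec[of n] finite_carrier_vec[of n, where 'a='a] card_gt_0_iff by blast

lemma measurable_into_Borel_HomI:
  fixes f :: "'b \<Rightarrow> (nat \<Rightarrow>\<^sub>0 'f::{field, finite}) \<Rightarrow> 'f vec"
  assumes "f \<in> space M \<rightarrow> Hom_carrier \<kappa>"
    and "\<And>n c. (\<And>i. i < n \<Longrightarrow> c i \<in> carrier_vec \<kappa>) \<Longrightarrow> f -` cylinder \<kappa> n c \<inter> space M \<in> sets M"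
  shows "f \<in> measurable M (Borel_sets_of (Hom_topology \<kappa>))"
proof (rule measurable_sigma_sets[OF sets_Borel_Hom cylinders_subset_Pow assms(1)])
  fix C :: "((nat \<Rightarrow>\<^sub>0 'f) \<Rightarrow> 'f vec) set" assume "C \<in> cylinders \<kappa>"
  then show "f -` C \<inter> space M \<in> sets M"
    by (cases rule: cylinders_cases) (simp_all add: assms(2))
qed

text \<open>The pi-lambda argument: cylinders form an intersection-stable generator, and the
  cylinder with \<open>n = 0\<close> is the whole group, which has finite mass.\<close>

lemma measure_Hom_eqI:
  fixes M N :: "((nat \<Rightarrow>\<^sub>0 'f::{field, finite}) \<Rightarrow> 'f vec) measure"
  assumes M: "prob_space M" "sets M = sets (Borel_sets_of (Hom_topology \<kappa>))"
    and N: "sets N = sets (Borel_sets_of (Hom_topology \<kappa>))"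
    and eq: "\<And>n c. (\<And>i. i < n \<Longrightarrow> c i \<in> carrier_vec \<kappa>) \<Longrightarrow>
      emeasure M (cylinder \<kappa> n c) = emeasure N (cylinder \<kappa> n c)"
  shows "M = N"
proof (rule measure_eqI_generator_eq_countable[OF Int_stable_cylinders cylinders_subset_Pow])
  show "emeasure M C = emeasure N C" if "C \<in> cylinders \<kappa>" for C
    using that by (cases rule: cylinders_cases) (simp_all add: eq)
  show "sets M = sigma_sets (Hom_carrier \<kappa>) (cylinders \<kappa>)"
    "sets N = sigma_sets (Hom_carrier \<kappa>) (cylinders \<kappa>)"
    using M(2) N by (simp_all add: sets_Borel_Hom)
  show "{cylinder \<kappa> 0 undefined} \<subseteq> cylinders \<kappa>" "\<Union>{cylinder \<kappa> 0 undefined} = Hom_carrier \<kappa>"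
    using cylinder_in_cylinders[of \<kappa> 0] by (simp_all add: cylinder_0)
qed (simp_all add: prob_space.finite_measure finite_measure.emeasure_finite M(1))

section \<open>Translations of the group\<close>

lemma Hom_add:
  assumes "g \<in> Hom_carrier \<kappa>" "h \<in> Hom_carrier \<kappa>"
  shows "(\<lambda>x. g x + h x) \<in> Hom_carrier \<kappa>"
proof -
  have "g (x + y) + h (x + y) = (g x + h x) + (g y + h y)" for x y
    using HomD(1)[OF assms(1), of x] HomD(1)[OF assms(1), of y]
      HomD(1)[OF assms(2), of x] HomD(1)[OF assms(2), of y]
    unfolding HomD(2)[OF assms(1)] HomD(2)[OF assms(2)] by (intro eq_vecI) auto
  moreover have "g (dsum_scale c x) + h (dsum_scale c x) = c \<cdot>\<^sub>v (g x + h x)" for c x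
    using HomD(1)[OF assms(1), of x] HomD(1)[OF assms(2), of x]
    unfolding HomD(3)[OF assms(1)] HomD(3)[OF assms(2)] by (simp add: smult_add_distrib_vec)
  ultimately show ?thesis using assms by (auto simp: Hom_carrier_def)
qed

lemma Hom_uminus:
  assumes "g \<in> Hom_carrier \<kappa>"
  shows "(\<lambda>x. - g x) \<in> Hom_carrier \<kappa>"
proof -
  have "- g (x + y) = - g x + - g y" for x y
    using HomD(1)[OF assms(1), of x] HomD(1)[OF assms(1), of y]
    unfolding HomD(2)[OF assms(1)] by (intro eq_vecI) auto
  moreover have "- g (dsum_scale c x) = c \<cdot>\<^sub>v (- g x)" for c x
    unfolding HomD(3)[OF assms(1)] by (intro eq_vecI) auto
  ultimately show ?thesis using assms by (auto simp: Hom_carrier_def)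
qed

lemma add_uminus_cancel_vec:
  fixes a b :: "'a::ab_group_add vec"
  assumes "a \<in> carrier_vec n" "b \<in> carrier_vec n"
  shows "a + (- a + b) = b" "- a + (a + b) = b"
  using assms by (auto intro!: eq_vecI)

text \<open>Translation by \<open>g\<close> is inverse to translation by its negative. Invariance is
  stated for images, while measurability and \<open>distr\<close> concern preimages; this equation
  passes between them.\<close>

lemma translate_image_eq:
  assumes g: "g \<in> Hom_carrier \<kappa>" and A: "A \<subseteq> Hom_carrier \<kappa>"
  shows "(\<lambda>h x. g x + h x) ` A = (\<lambda>h x. - g x + h x) -` A \<inter> Hom_carrier \<kappa>"
proof (intro equalityI subsetI)
  fix h' assume "h' \<in> (\<lambda>h x. g x + h x) ` A"
  then obtain h where h: "h \<in> A" "h' = (\<lambda>x. g x + h x)" by blast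
  then have hH: "h \<in> Hom_carrier \<kappa>" using A by blast
  have "(\<lambda>x. - g x + h' x) = h"
    using add_uminus_cancel_vec(2)[OF HomD(1)[OF g] HomD(1)[OF hH]] h(2) by simp
  then show "h' \<in> (\<lambda>h x. - g x + h x) -` A \<inter> Hom_carrier \<kappa>"
    using h Hom_add[OF g hH] by simp
next
  fix h assume "h \<in> (\<lambda>h x. - g x + h x) -` A \<inter> Hom_carrier \<kappa>"
  then have h: "(\<lambda>x. - g x + h x) \<in> A" "h \<in> Hom_carrier \<kappa>" by auto
  have "h = (\<lambda>x. g x + (- g x + h x))"
    using add_uminus_cancel_vec(1)[OF HomD(1)[OF g] HomD(1)[OF h(2)]] by simp
  then show "h \<in> (\<lambda>h x. g x + h x) ` A"
    using h(1) by (rule image_eqI)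
qed

text \<open>Adding \<open>g\<close> shifts the prescribed values by those of \<open>g\<close>, so
  translations permute the cylinders with a given \<open>n\<close>.\<close>

lemma translate_vimage_cylinder:
  assumes g: "g \<in> Hom_carrier \<kappa>" and c: "\<And>i. i < n \<Longrightarrow> c i \<in> carrier_vec \<kappa>"
  shows "(\<lambda>h x. - g x + h x) -` cylinder \<kappa> n c \<inter> Hom_carrier \<kappa> = cylinder \<kappa> n (\<lambda>i. g (unit_seq i) + c i)"
proof (intro equalityI subsetI)
  fix h assume h: "h \<in> (\<lambda>h x. - g x + h x) -` cylinder \<kappa> n c \<inter> Hom_carrier \<kappa>"
  then have hH: "h \<in> Hom_carrier \<kappa>" by simp
  have "h (unit_seq i) = g (unit_seq i) + c i" if "i < n" for i
  proof -
    have "- g (unit_seq i) + h (unit_seq i) = c i"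
      using h that by (auto simp: cylinder_def)
    then show ?thesis
      using add_uminus_cancel_vec(1)[OF HomD(1)[OF g] HomD(1)[OF hH]] by metis
  qed
  then show "h \<in> cylinder \<kappa> n (\<lambda>i. g (unit_seq i) + c i)" using hH by (simp add: cylinder_def)
next
  fix h assume h: "h \<in> cylinder \<kappa> n (\<lambda>i. g (unit_seq i) + c i)"
  then have hH: "h \<in> Hom_carrier \<kappa>" by (simp add: cylinder_def)
  have "- g (unit_seq i) + h (unit_seq i) = c i" if "i < n" for i
    using h that add_uminus_cancel_vec(2)[OF HomD(1)[OF g] c[OF that]] by (simp add: cylinder_def)
  then show "h \<in> (\<lambda>h x. - g x + h x) -` cylinder \<kappa> n c \<inter> Hom_carrier \<kappa>"
    using hH Hom_add[OF Hom_uminus[OF g] hH] by (simp add: cylinder_def)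
qed

section \<open>Mass of a cylinder, uniqueness and existence\<close>

lemma normalized_Haar_cylinder:
  fixes M :: "((nat \<Rightarrow>\<^sub>0 'f::{field, finite}) \<Rightarrow> 'f vec) measure"
  assumes M: "normalized_Haar (Hom_topology \<kappa>) (\<lambda>g h x. g x + h x) M"
    and c: "\<And>i. i < n \<Longrightarrow> c i \<in> carrier_vec \<kappa>"
  shows "measure M (cylinder \<kappa> n c) = 1 / real (card (carrier_vec \<kappa> :: 'f vec set)) ^ n"
proof -
  interpret M: prob_space M using M by (simp add: normalized_Haar_def)
  have sets: "sets M = sets (Borel_sets_of (Hom_topology \<kappa>))"
    using M by (simp add: normalized_Haar_def)
  then have sp: "space M = Hom_carrier \<kappa>"
    using sets_eq_imp_space_eq[OF sets] by (simp add: space_Borel_sets_of topspace_Hom_topology)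
  have cs: "cylinder \<kappa> n d \<in> sets M" for d
    unfolding sets by (rule openin_imp_Borel[OF openin_cylinder])
  let ?z = "\<lambda>_::nat. 0\<^sub>v \<kappa> :: 'f vec"
  have eq: "measure M (cylinder \<kappa> n d) = measure M (cylinder \<kappa> n ?z)"
    if d: "\<And>i. i < n \<Longrightarrow> d i \<in> carrier_vec \<kappa>" for d
  proof -
    \<comment> \<open>The linear extension of \<open>d\<close> is the group element that carries the
      cylinder of zero data onto the cylinder of \<open>d\<close>.\<close>
    let ?g = "lin_ext \<kappa> d"
    have g: "?g \<in> Hom_carrier \<kappa>" by (rule lin_ext_in_Hom)
    have "(\<lambda>h x. ?g x + h x) ` cylinder \<kappa> n ?z = cylinder \<kappa> n (\<lambda>i. ?g (unit_seq i) + 0\<^sub>v \<kappa>)"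
      using translate_image_eq[OF g cylinder_subset_Hom] translate_vimage_cylinder[OF g, of n ?z] by simp
    also have "\<dots> = cylinder \<kappa> n d"
      using d by (intro cylinder_cong) (simp add: lin_ext_unit_seq)
    finally have "emeasure M (cylinder \<kappa> n d) = emeasure M (cylinder \<kappa> n ?z)"
      using M g cs by (simp add: normalized_Haar_def topspace_Hom_topology) metis
    then show ?thesis by (simp add: measure_def)
  qed
  \<comment> \<open>The cylinders with data in \<open>?P\<close> partition the group into pieces of
    equal mass. Their number is the \<open>n\<close>-th power of the size of
    \<open>carrier_vec \<kappa>\<close>, and their masses add up to 1.\<close>
  let ?P = "{..<n} \<rightarrow>\<^sub>E (carrier_vec \<kappa> :: 'f vec set)"
  have fin: "finite ?P" by (intro finite_PiE finite_carrier_vec) simp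
  have "(\<Union>d\<in>?P. cylinder \<kappa> n d) = space M"
  proof (intro equalityI subsetI)
    fix h assume "h \<in> space M"
    then have h: "h \<in> Hom_carrier \<kappa>" by (simp add: sp)
    then have "h \<in> cylinder \<kappa> n (restrict (\<lambda>i. h (unit_seq i)) {..<n})" by (simp add: cylinder_def)
    moreover have "restrict (\<lambda>i. h (unit_seq i)) {..<n} \<in> ?P" using HomD(1)[OF h] by simp
    ultimately show "h \<in> (\<Union>d\<in>?P. cylinder \<kappa> n d)" by (rule UN_I[rotated])
  qed (auto simp: sp cylinder_def)
  then have "1 = measure M (\<Union>d\<in>?P. cylinder \<kappa> n d)" by (simp add: M.prob_space)
  also have "\<dots> = (\<Sum>d\<in>?P. measure M (cylinder \<kappa> n d))"
  proof (rule M.finite_measure_finite_Union[OF fin])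
    show "disjoint_family_on (cylinder \<kappa> n) ?P"
      unfolding disjoint_family_on_def
    proof (intro ballI impI)
      fix a b assume a: "a \<in> ?P" and b: "b \<in> ?P" and "a \<noteq> b"
      then obtain i where "i < n" "a i \<noteq> b i" using PiE_ext[OF a b] by auto
      then show "cylinder \<kappa> n a \<inter> cylinder \<kappa> n b = {}" by (auto simp: cylinder_def)
    qed
  qed (use cs in auto)
  also have "\<dots> = (\<Sum>d\<in>?P. measure M (cylinder \<kappa> n ?z))"
    by (intro sum.cong eq refl) auto
  also have "\<dots> = real (card (carrier_vec \<kappa> :: 'f vec set)) ^ n * measure M (cylinder \<kappa> n ?z)"
    by (simp add: card_PiE)
  finally have "measure M (cylinder \<kappa> n ?z) = 1 / real (card (carrier_vec \<kappa> :: 'f vec set)) ^ n"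
    using card_carrier_vec_pos[of \<kappa>, where 'a='f] by (simp add: eq_divide_eq mult.commute)
  then show ?thesis using eq[OF c] by simp
qed

lemma normalized_Haar_Hom_unique:
  fixes M N :: "((nat \<Rightarrow>\<^sub>0 'f::{field, finite}) \<Rightarrow> 'f vec) measure"
  assumes M: "normalized_Haar (Hom_topology \<kappa>) (\<lambda>g h x. g x + h x) M"
    and N: "normalized_Haar (Hom_topology \<kappa>) (\<lambda>g h x. g x + h x) N"
  shows "M = N"
proof -
  interpret M: prob_space M using M by (simp add: normalized_Haar_def)
  interpret N: prob_space N using N by (simp add: normalized_Haar_def)
  show ?thesis
  proof (rule measure_Hom_eqI)
    show "emeasure M (cylinder \<kappa> n c) = emeasure N (cylinder \<kappa> n c)"
      if "\<And>i. i < n \<Longrightarrow> c i \<in> carrier_vec \<kappa>" for n c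
      using normalized_Haar_cylinder[OF M that] normalized_Haar_cylinder[OF N that]
      by (simp add: M.emeasure_eq_measure N.emeasure_eq_measure)
  qed (use M N in \<open>simp_all add: normalized_Haar_def\<close>)
qed

text \<open>Values on the unit sequences are drawn independently and uniformly from
  \<open>carrier_vec \<kappa>\<close>; the law of their linear extension is the required
  measure.\<close>

lemma normalized_Haar_Hom_exists:
  "\<exists>M. normalized_Haar (Hom_topology \<kappa> :: ((nat \<Rightarrow>\<^sub>0 'f::{field, finite}) \<Rightarrow> 'f vec) topology)
     (\<lambda>g h x. g x + h x) M"
proof -
  let ?B = "Borel_sets_of (Hom_topology \<kappa>) :: ((nat \<Rightarrow>\<^sub>0 'f) \<Rightarrow> 'f vec) measure"
  let ?C = "carrier_vec \<kappa> :: 'f vec set"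
  let ?U = "\<lambda>_::nat. uniform_count_measure ?C"
  let ?P = "PiM UNIV ?U"
  have "?C \<noteq> {}" using zero_carrier_vec by blast
  then have "prob_space (uniform_count_measure ?C)"
    by (intro prob_space_uniform_count_measure finite_carrier_vec)
  then interpret P: product_prob_space ?U UNIV
    by (simp add: product_prob_space_def product_prob_space_axioms_def product_sigma_finite_def
        prob_space_imp_sigma_finite)
  have spP: "a i \<in> ?C" if "a \<in> space ?P" for a i
    using that by (auto simp: space_PiM space_uniform_count_measure)
  \<comment> \<open>Since \<open>lin_ext\<close> takes the drawn values on unit sequences, a
    cylinder pulls back to a condition on the first \<open>n\<close> coordinates.\<close>
  have pre: "lin_ext \<kappa> -` cylinder \<kappa> n c \<inter> space ?P = {a \<in> space ?P. \<forall>i\<in>{..<n}. a i \<in> {c i}}"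
    for n c
    using spP by (auto simp: cylinder_def lin_ext_in_Hom lin_ext_unit_seq)
  have cylP: "{a \<in> space ?P. \<forall>i\<in>{..<n}. a i \<in> {c i}} \<in> sets ?P"
    if c: "\<And>i. i < n \<Longrightarrow> c i \<in> ?C" for n c
  proof (rule sets.sets_Collect_finite_All)
    fix i assume "i \<in> {..<n}"
    then have "{c i} \<in> sets (?U i)" using c by (simp add: sets_uniform_count_measure)
    then have "(\<lambda>a. a i) -` {c i} \<inter> space ?P \<in> sets ?P"
      by (intro measurable_sets[OF measurable_component_singleton]) auto
    moreover have "(\<lambda>a. a i) -` {c i} \<inter> space ?P = {a \<in> space ?P. a i \<in> {c i}}" by auto
    ultimately show "{a \<in> space ?P. a i \<in> {c i}} \<in> sets ?P" by simp
  qed simp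
  have meas: "lin_ext \<kappa> \<in> measurable ?P ?B"
    using lin_ext_in_Hom cylP by (intro measurable_into_Borel_HomI) (auto simp: pre)
  define M where "M = distr ?P ?B (lin_ext \<kappa>)"
  have M: "prob_space M" unfolding M_def by (rule P.prob_space_distr[OF meas])
  have setsM: "sets M = sets ?B" by (simp add: M_def)
  have spM: "space M = Hom_carrier \<kappa>"
    by (simp add: M_def space_Borel_sets_of topspace_Hom_topology)
  \<comment> \<open>For admissible data the mass depends on \<open>n\<close> alone. This is the
    source of translation invariance.\<close>
  have M_cyl: "emeasure M (cylinder \<kappa> n c) = (\<Prod>i<n. ennreal (1 / card ?C))"
    if c: "\<And>i. i < n \<Longrightarrow> c i \<in> ?C" for n c
  proof -
    have "emeasure M (cylinder \<kappa> n c) = emeasure ?P {a \<in> space ?P. \<forall>i\<in>{..<n}. a i \<in> {c i}}"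
      unfolding M_def by (simp only: emeasure_distr[OF meas openin_imp_Borel[OF openin_cylinder]] pre)
    also have "\<dots> = (\<Prod>i<n. emeasure (?U i) {c i})"
      using c by (intro P.emeasure_PiM_Collect) (auto simp: sets_uniform_count_measure)
    also have "\<dots> = (\<Prod>i<n. ennreal (1 / card ?C))"
      using c by (intro prod.cong) (simp_all add: emeasure_uniform_count_measure finite_carrier_vec)
    finally show ?thesis .
  qed
  have "emeasure M ((\<lambda>h x. g x + h x) ` A) = emeasure M A"
    if g: "g \<in> Hom_carrier \<kappa>" and A: "A \<in> sets M" for g :: "(nat \<Rightarrow>\<^sub>0 'f) \<Rightarrow> 'f vec" and A
  proof -
    let ?T = "\<lambda>h x. - g x + h x"
    have T: "?T \<in> measurable M ?B"
    proof (rule measurable_into_Borel_HomI)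
      show "?T \<in> space M \<rightarrow> Hom_carrier \<kappa>"
        unfolding spM using Hom_add[OF Hom_uminus[OF g]] by blast
      show "?T -` cylinder \<kappa> n c \<inter> space M \<in> sets M"
        if "\<And>i. i < n \<Longrightarrow> c i \<in> carrier_vec \<kappa>" for n c
      proof -
        have "?T -` cylinder \<kappa> n c \<inter> space M = cylinder \<kappa> n (\<lambda>i. g (unit_seq i) + c i)"
          unfolding spM by (rule translate_vimage_cylinder[OF g that])
        then show ?thesis by (simp add: setsM openin_imp_Borel[OF openin_cylinder])
      qed
    qed
    \<comment> \<open>Both measures need only be compared on cylinders, and the translation replaces
      admissible data by admissible data of the same length.\<close>
    have "M = distr M ?B ?T"
    proof (rule measure_Hom_eqI[OF M setsM])
      fix n and c :: "nat \<Rightarrow> 'f vec" assume c: "\<And>i. i < n \<Longrightarrow> c i \<in> carrier_vec \<kappa>"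
      have "emeasure (distr M ?B ?T) (cylinder \<kappa> n c) = emeasure M (?T -` cylinder \<kappa> n c \<inter> space M)"
        by (rule emeasure_distr[OF T openin_imp_Borel[OF openin_cylinder]])
      also have "\<dots> = emeasure M (cylinder \<kappa> n (\<lambda>i. g (unit_seq i) + c i))"
        unfolding spM by (rule arg_cong[OF translate_vimage_cylinder[OF g c]])
      also have "\<dots> = emeasure M (cylinder \<kappa> n c)"
        using c HomD(1)[OF g] by (simp add: M_cyl)
      finally show "emeasure M (cylinder \<kappa> n c) = emeasure (distr M ?B ?T) (cylinder \<kappa> n c)" ..
    qed simp
    then have "emeasure M A = emeasure (distr M ?B ?T) A" by simp
    also have "\<dots> = emeasure M (?T -` A \<inter> space M)"
      using A by (intro emeasure_distr[OF T]) (simp add: setsM)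
    also have "?T -` A \<inter> space M = (\<lambda>h x. g x + h x) ` A"
      using translate_image_eq[OF g, of A] sets.sets_into_space[OF A] by (simp add: spM)
    finally show ?thesis ..
  qed
  then show ?thesis
    using M setsM by (intro exI[of _ M]) (simp add: normalized_Haar_def topspace_Hom_topology)
qed

text \<open>Existence and uniqueness ensure that the definite description in \<open>Haar_Hom\<close>
  denotes a measure with the defining properties.\<close>

lemma normalized_Haar_Haar_Hom:
  "normalized_Haar (Hom_topology \<kappa>) (\<lambda>g h x. g x + h x)
     (Haar_Hom \<kappa> :: ((nat \<Rightarrow>\<^sub>0 'f::{field, finite}) \<Rightarrow> 'f vec) measure)"
  unfolding Haar_Hom_def
  by (rule theI') (use normalized_Haar_Hom_exists normalized_Haar_Hom_unique in blast)

section \<open>The law of the kernel\<close>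

text \<open>Membership of \<open>v\<close> in the kernel depends only on the value at
  \<open>v\<close>, and evaluation at \<open>v\<close> is continuous into a discrete space.\<close>

lemma continuous_map_Ker:
  "continuous_map (Hom_topology \<kappa>) Sub_topology (Ker \<kappa> :: ((nat \<Rightarrow>\<^sub>0 'f::field) \<Rightarrow> 'f vec) \<Rightarrow> _)"
proof -
  have cont: "continuous_map (Hom_topology \<kappa>)
      (product_topology (\<lambda>_. discrete_topology (UNIV :: bool set)) UNIV) (\<lambda>(h :: (nat \<Rightarrow>\<^sub>0 'f) \<Rightarrow> 'f vec) v. v \<in> Ker \<kappa> h)"
    unfolding continuous_map_componentwise_UNIV
  proof
    fix v :: "nat \<Rightarrow>\<^sub>0 'f"
    have "continuous_map (discrete_topology (carrier_vec \<kappa>)) (discrete_topology (UNIV :: bool set)) (\<lambda>y :: 'f vec. y = 0\<^sub>v \<kappa>)"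
      by (simp add: continuous_map_def)
    from continuous_map_compose[OF continuous_map_Hom_eval this]
    show "continuous_map (Hom_topology \<kappa>) (discrete_topology UNIV) (\<lambda>h :: (nat \<Rightarrow>\<^sub>0 'f) \<Rightarrow> 'f vec. v \<in> Ker \<kappa> h)"
      by (simp add: o_def Ker_def)
  qed
  \<comment> \<open>Open sets of \<open>Sub_topology\<close> are traces of open sets of the product
    on the set of subspaces. Kernels are subspaces, so continuity into the product is
    enough.\<close>
  have "openin (Hom_topology \<kappa>) {h :: (nat \<Rightarrow>\<^sub>0 'f) \<Rightarrow> 'f vec. h \<in> topspace (Hom_topology \<kappa>) \<and> Ker \<kappa> h \<in> U}"
    if UO: "openin Sub_topology U" for U :: "(nat \<Rightarrow>\<^sub>0 'f) set set"
  proof -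
    obtain W where W: "openin (product_topology (\<lambda>_. discrete_topology (UNIV :: bool set)) UNIV) W"
      and U: "U = (\<lambda>X v. v \<in> X) -` W \<inter> {X. dsum.subspace X}"
      using UO unfolding Sub_topology_def openin_pullback_topology by blast
    have "{h :: (nat \<Rightarrow>\<^sub>0 'f) \<Rightarrow> 'f vec. h \<in> topspace (Hom_topology \<kappa>) \<and> Ker \<kappa> h \<in> U} =
        {h \<in> topspace (Hom_topology \<kappa>). (\<lambda>v. v \<in> Ker \<kappa> h) \<in> W}"
      using subspace_Ker by (auto simp: U topspace_Hom_topology)
    then show ?thesis using openin_continuous_map_preimage[OF cont W] by simp
  qed
  then show ?thesis
    using subspace_Ker
    by (auto simp: continuous_map_def topspace_Hom_topology Sub_topology_def topspace_pullback_topology)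
qed

text \<open>\<open>V_n n\<close> is finite over a finite field, so the condition involves only
  finitely many coordinates of the indicator function of \<open>X\<close>. Openness makes the event
  measurable.\<close>

lemma openin_dim_Int_V_n:
  "openin Sub_topology
     {X :: (nat \<Rightarrow>\<^sub>0 'f::{field, finite}) set. dsum.subspace X \<and> dsum.dim (X \<inter> V_n n) = k}"
proof -
  \<comment> \<open>For a general \<open>p\<close> the set need not be a subspace; what matters is
    that the condition depends only on the restriction of \<open>p\<close> to
    \<open>V_n n\<close>.\<close>
  let ?W = "{p :: (nat \<Rightarrow>\<^sub>0 'f) \<Rightarrow> bool. dsum.dim ({v. p v} \<inter> V_n n) = k}"
  have "openin (product_topology (\<lambda>_. discrete_topology (UNIV :: bool set)) UNIV) ?W"
    unfolding openin_product_topology_alt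
  proof
    fix p assume p: "p \<in> ?W"
    \<comment> \<open>A basic neighbourhood of \<open>p\<close> that fixes its values on the finite
      set \<open>V_n n\<close> and leaves all others free.\<close>
    let ?U = "\<lambda>v. if v \<in> V_n n then {p v} else UNIV"
    have "{v. ?U v \<noteq> UNIV} \<subseteq> V_n n" by auto
    then have "finite {v. ?U v \<noteq> UNIV}" using finite_V_n finite_subset by blast
    moreover have "Pi\<^sub>E UNIV ?U \<subseteq> ?W"
    proof
      fix p' assume p': "p' \<in> Pi\<^sub>E UNIV ?U"
      have "p' v = p v" if "v \<in> V_n n" for v
        using PiE_mem[OF p', of v] that by simp
      then have "{v. p' v} \<inter> V_n n = {v. p v} \<inter> V_n n" by blast
      then show "p' \<in> ?W" using p by simp
    qed
    moreover have "p \<in> Pi\<^sub>E UNIV ?U" by (auto simp: PiE_iff)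
    ultimately show "\<exists>U. finite {v \<in> UNIV. U v \<noteq> topspace (discrete_topology UNIV)} \<and>
        (\<forall>v\<in>UNIV. openin (discrete_topology UNIV) (U v)) \<and> p \<in> Pi\<^sub>E UNIV U \<and> Pi\<^sub>E UNIV U \<subseteq> ?W"
      by (intro exI[of _ ?U]) simp
  qed
  moreover have "{X :: (nat \<Rightarrow>\<^sub>0 'f) set. dsum.subspace X \<and> dsum.dim (X \<inter> V_n n) = k} =
      (\<lambda>X v. v \<in> X) -` ?W \<inter> {X. dsum.subspace X}"
    by auto
  ultimately show ?thesis
    unfolding Sub_topology_def openin_pullback_topology by blast
qed

text \<open>Each \<open>h\<close> lies in the cylinder of the matrix of its values, and rank-nullity
  converts the dimension into the rank. The form \<open>k + rank = n\<close> stays correct for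
  \<open>k > n\<close>, where a truncated difference would not.\<close>

lemma dim_Ker_event_eq_cylinders:
  "{h \<in> Hom_carrier \<kappa>. dsum.dim (Ker \<kappa> h \<inter> V_n n) = k} =
     (\<Union>A\<in>{A :: 'f::{field, finite} mat. A \<in> carrier_mat \<kappa> n \<and> k + vec_space.rank \<kappa> A = n}.
        cylinder \<kappa> n (col A))"
proof (intro equalityI subsetI)
  fix h :: "(nat \<Rightarrow>\<^sub>0 'f) \<Rightarrow> 'f vec"
  assume h: "h \<in> {h \<in> Hom_carrier \<kappa>. dsum.dim (Ker \<kappa> h \<inter> V_n n) = k}"
  let ?A = "mat \<kappa> n (\<lambda>(j, i). h (unit_seq i) $ j)"
  have hH: "h \<in> Hom_carrier \<kappa>" using h by simp
  have A: "?A \<in> carrier_mat \<kappa> n" by simp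
  have c: "h (unit_seq i) = col ?A i" if "i < n" for i
    using that HomD(1)[OF hH, of "unit_seq i"] by (intro eq_vecI) auto
  have "k + vec_space.rank \<kappa> ?A = n" using dim_Ker_V_n[OF hH A c] h by simp
  moreover have "h \<in> cylinder \<kappa> n (col ?A)" using hH c unfolding cylinder_def by blast
  ultimately show "h \<in> (\<Union>A\<in>{A. A \<in> carrier_mat \<kappa> n \<and> k + vec_space.rank \<kappa> A = n}. cylinder \<kappa> n (col A))"
    using A by blast
next
  fix h :: "(nat \<Rightarrow>\<^sub>0 'f) \<Rightarrow> 'f vec"
  assume "h \<in> (\<Union>A\<in>{A. A \<in> carrier_mat \<kappa> n \<and> k + vec_space.rank \<kappa> A = n}. cylinder \<kappa> n (col A))"
  then obtain A where A: "A \<in> carrier_mat \<kappa> n" "k + vec_space.rank \<kappa> A = n" and h: "h \<in> cylinder \<kappa> n (col A)"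
    by blast
  have hH: "h \<in> Hom_carrier \<kappa>" and c: "\<And>i. i < n \<Longrightarrow> h (unit_seq i) = col A i"
    using h by (auto simp: cylinder_def)
  show "h \<in> {h \<in> Hom_carrier \<kappa>. dsum.dim (Ker \<kappa> h \<inter> V_n n) = k}"
    using dim_Ker_V_n[OF hH A(1) c] A(2) hH by simp
qed

text \<open>The event is a disjoint union of cylinders, one for each matrix counted in the
  numerator, and each has mass one over the number of all matrices. Both cases of the theorem are
  read off from this formula.\<close>

lemma v_tilde_eq:
  "v_tilde TYPE('f::{field, finite}) \<kappa> n k =
     real (card {A :: 'f mat. A \<in> carrier_mat \<kappa> n \<and> k + vec_space.rank \<kappa> A = n}) /
     real (card (carrier_mat \<kappa> n :: 'f mat set))"
proof -
  let ?M = "Haar_Hom \<kappa> :: ((nat \<Rightarrow>\<^sub>0 'f) \<Rightarrow> 'f vec) measure"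
  let ?S = "{X :: (nat \<Rightarrow>\<^sub>0 'f) set. dsum.subspace X \<and> dsum.dim (X \<inter> V_n n) = k}"
  let ?R = "{A :: 'f mat. A \<in> carrier_mat \<kappa> n \<and> k + vec_space.rank \<kappa> A = n}"
  note Haar = normalized_Haar_Haar_Hom[of \<kappa>, where 'f='f]
  interpret M: prob_space ?M using Haar by (simp add: normalized_Haar_def)
  have sets: "sets ?M = sets (Borel_sets_of (Hom_topology \<kappa>))"
    using Haar by (simp add: normalized_Haar_def)
  have sp: "space ?M = Hom_carrier \<kappa>"
    using sets_eq_imp_space_eq[OF sets] by (simp add: space_Borel_sets_of topspace_Hom_topology)
  have Ker: "Ker \<kappa> \<in> measurable ?M (Borel_sets_of Sub_topology)"
    using continuous_map_imp_Borel_measurable[OF continuous_map_Ker]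
    by (simp only: measurable_cong_sets[OF sets refl])
  have "finite (carrier_mat \<kappa> n :: 'f mat set)"
    using card_carrier_vec_pos[of \<kappa>, where 'a='f]
    by (intro card_ge_0_finite) (simp add: card_carrier_mat)
  then have fin: "finite ?R" by (rule finite_subset[rotated]) auto
  have "v_tilde TYPE('f) \<kappa> n k = measure ?M (Ker \<kappa> -` ?S \<inter> space ?M)"
    unfolding v_tilde_def mu_def
    by (rule measure_distr[OF Ker openin_imp_Borel[OF openin_dim_Int_V_n]])
  also have "Ker \<kappa> -` ?S \<inter> space ?M = {h \<in> Hom_carrier \<kappa>. dsum.dim (Ker \<kappa> h \<inter> V_n n) = k}"
    using subspace_Ker by (auto simp: sp)
  also have "\<dots> = (\<Union>A\<in>?R. cylinder \<kappa> n (col A))"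
    by (rule dim_Ker_event_eq_cylinders)
  also have "measure ?M \<dots> = (\<Sum>A\<in>?R. measure ?M (cylinder \<kappa> n (col A)))"
  proof (rule M.finite_measure_finite_Union[OF fin])
    show "(\<lambda>A. cylinder \<kappa> n (col A)) ` ?R \<subseteq> sets ?M"
      unfolding sets by (intro image_subsetI openin_imp_Borel openin_cylinder)
    show "disjoint_family_on (\<lambda>A. cylinder \<kappa> n (col A)) ?R"
      unfolding disjoint_family_on_def
    proof (intro ballI impI)
      fix A B assume A: "A \<in> ?R" and B: "B \<in> ?R" and "A \<noteq> B"
      \<comment> \<open>Distinct matrices differ in some column, so their cylinders prescribe
        different values at the corresponding unit sequence.\<close>
      have "\<exists>i<n. col A i \<noteq> col B i"
      proof (rule ccontr)
        assume "\<not> (\<exists>i<n. col A i \<noteq> col B i)"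
        then have "restrict (col A) {..<n} = restrict (col B) {..<n}" by (intro restrict_ext) auto
        then have "A = B"
          using A B by (intro inj_onD[OF bij_betw_imp_inj_on[OF bij_betw_cols[of n \<kappa>]]]) auto
        with \<open>A \<noteq> B\<close> show False ..
      qed
      then show "cylinder \<kappa> n (col A) \<inter> cylinder \<kappa> n (col B) = {}"
        by (auto simp: cylinder_def)
    qed
  qed
  also have "\<dots> = (\<Sum>A\<in>?R. 1 / real (card (carrier_mat \<kappa> n :: 'f mat set)))"
  proof (rule sum.cong)
    fix A assume "A \<in> ?R"
    then have "col A i \<in> carrier_vec \<kappa>" if "i < n" for i using that by auto
    from normalized_Haar_cylinder[OF Haar this]
    show "measure ?M (cylinder \<kappa> n (col A)) = 1 / real (card (carrier_mat \<kappa> n :: 'f mat set))"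
      by (simp add: card_carrier_mat)
  qed simp
  finally show ?thesis by simp
qed

theorem theorem1p7:
  fixes \<kappa> n k :: nat
  shows "(k \<le> n \<and> n - k \<le> \<kappa> \<longrightarrow>
            v_tilde TYPE('f::{field, finite}) \<kappa> n k =
              real (card {A :: 'f mat. A \<in> carrier_mat \<kappa> n \<and> vec_space.rank \<kappa> A = n - k}) /
              real (card (carrier_mat \<kappa> n :: 'f mat set))) \<and>
         (\<not> (k \<le> n \<and> n - k \<le> \<kappa>) \<longrightarrow> v_tilde TYPE('f) \<kappa> n k = 0)"
proof (intro conjI impI)
  assume "k \<le> n \<and> n - k \<le> \<kappa>"
  \<comment> \<open>For \<open>k \<le> n\<close> the truncated difference \<open>n - k\<close> is
    the true one.\<close>
  then have "k + r = n \<longleftrightarrow> r = n - k" for r by auto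
  then show "v_tilde TYPE('f) \<kappa> n k =
      real (card {A :: 'f mat. A \<in> carrier_mat \<kappa> n \<and> vec_space.rank \<kappa> A = n - k}) /
      real (card (carrier_mat \<kappa> n :: 'f mat set))"
    by (simp add: v_tilde_eq)
next
  assume *: "\<not> (k \<le> n \<and> n - k \<le> \<kappa>)"
  \<comment> \<open>If \<open>k > n\<close>, the sum is already too large; otherwise
    \<open>n - k > \<kappa>\<close>, and the rank is at most \<open>\<kappa>\<close>.\<close>
  have "k + vec_space.rank \<kappa> A \<noteq> n" if "A \<in> carrier_mat \<kappa> n" for A :: "'f mat"
    using rank_le_dim_row[OF that] * by linarith
  then have "{A :: 'f mat. A \<in> carrier_mat \<kappa> n \<and> k + vec_space.rank \<kappa> A = n} = {}" by blast
  then show "v_tilde TYPE('f) \<kappa> n k = 0"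
    by (simp only: v_tilde_eq) simp
qed

end
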